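(* Suppose the control-affine assumption (C) of the context holds, let $t\in\{0,\ldots,K-1\}$, and let $v:\mathcal{Z}_{t+1}\to\mathbb{R}$ be bounded and measurable. Then for each fixed $x\in\mathcal{Z}_t$ the optimization problem $$\begin{aligned}\inf_{u,\gamma}\quad & r(x,u)+\sum_{s=1}^N\sum_{i=1}^{M_{t+1}}p_s\gamma_{s,i}v(x^{[i]})\\ \text{s.t.}\quad & f(x,u,\hat\xi^{[s]})=\sum_{i=1}^{M_{t+1}}\gamma_{s,i}x^{[i]}\quad\forall s\in\{1,\ldots,N\},\\ & u\in\mathcal{U}(x),\quad \gamma_s\in\Delta\quad\forall s\in\{1,\ldots,N\}\end{aligned}$$ is a convex program in the variables $(u,\gamma)$.
   Context: Setting. $K\ge1$ is an integer; $\mathcal{X}\subseteq\mathbb{R}^n$, $\mathcal{U}\subseteq\mathbb{R}^m$ are Borel sets; $\mathcal{U}(x)\subseteq\mathcal{U}$ is a nonempty Borel set for each $x\in\mathcal{X}$; $\Xi=\{\hat\xi^{[1]},\ldots,\hat\xi^{[N]}\}\subset\mathbb{R}^l$ is the finite support of the disturbance $\xi$, with $p_s:=\mathrm{Prob}(\xi=\hat\xi^{[s]})$, $\sum_s p_s=1$; $f:\mathcal{X}\times\mathcal{U}\times\Xi\to\mathcal{X}$ and $r:\mathcal{X}\times\mathcal{U}\to\mathbb{R}$ are measurable. $\mathcal{Z}_0\subseteq\cdots\subseteq\mathcal{Z}_K\subseteq\mathcal{X}$ are convex compact sets with $f(x,u,\boldsymbol{\xi})\in\mathcal{Z}_{t+1}$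 for all $x\in\mathcal{Z}_t$, $u\in\mathcal{U}(x)$, $\boldsymbol{\xi}\in\Xi$, and $x^{[1]},\ldots,x^{[M_{t+1}]}$ are finitely many points (nodes) of $\mathcal{Z}_{t+1}$ whose convex hull is $\mathcal{Z}_{t+1}$. $\Delta:=\{\gamma\in\mathbb{R}^{M_{t+1}}:\sum_i\gamma_i=1,\gamma_i\ge0\}$. For each $x\in\mathcal{X}$ the set $\mathcal{U}(x)$ is represented by convex inequalities: $\mathcal{U}(x)=\{u\in\mathbb{R}^m:a_k(x,u)\le b_k(x),\ k=1,\ldots,N_{ineq}\}$ for functions $a_k:\mathcal{X}\times\mathbb{R}^m\to\mathbb{R}$, $b_k:\mathcal{X}\to\mathbb{R}$ with $u\mapsto a_k(x,u)$ convex for each fixed $x$ and each $k$. Control-affine assumption (C): $f(x,u,\boldsymbol{\xi})=g(x,\boldsymbol{\xi})+h(x,\boldsymbol{\xi})u$, where $g:\mathcal{X}\times\Xi\to\mathbb{R}^n$ and $h:\mathcal{X}\times\Xi\to\mathbb{R}^{n\times m}$ are (possibly nonlinear) measurable functions such that $g(\cdot,\boldsymbol{\xi})$ and $h(\cdot,\boldsymbol{\xi})$ are continuous for each $\boldsymbol{\xi}\in\Xi$; and $u\mapsto r(x,u)$ is convex on $\mathcal{U}(x)$ for each $x\in\mathcal{X}$. A convex program means the minimization of a convex function over a convex feasible set, with equality constraints that are affine in the variables. *)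

theory Defs
  imports "HOL-Probability.Probability"
begin

(* The optimization problem
     minimize objective z  subject to  z in set_constr  and
     eq_lhs s z = eq_rhs s z for all s.
   domain is where the functions appearing in the problem are meaningful; their
   values outside it carry no information (all HOL functions are total). *)
record ('v, 's, 'w) program =
  domain :: "'v set"
  objective :: "'v \<Rightarrow> real"
  set_constr :: "'v set"
  eq_lhs :: "'s \<Rightarrow> 'v \<Rightarrow> 'w"
  eq_rhs :: "'s \<Rightarrow> 'v \<Rightarrow> 'w"

definition feasible_set :: "('v, 's, 'w) program \<Rightarrow> 'v set" where
  "feasible_set P = {z \<in> set_constr P. \<forall>s. eq_lhs P s z = eq_rhs P s z}"

(* The set S need be neither convex nor affine, hence the definition through a
   globally defined affine map that agrees with F on S. *)
definition affine_map_on :: "'v::real_vector set \<Rightarrow> ('v \<Rightarrow> 'w::real_vector) \<Rightarrow> bool" where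
  "affine_map_on S F \<longleftrightarrow> (\<exists>A c. linear A \<and> (\<forall>z\<in>S. F z = A z + c))"

(* The objective is required to be convex on all of set_constr, not merely on the
   (possibly much smaller) feasible set; convex_on S includes convexity of S. *)
definition convex_program ::
  "('v::real_vector, 's, 'w::real_vector) program \<Rightarrow> bool" where
  "convex_program P \<longleftrightarrow>
     set_constr P \<subseteq> domain P \<and>
     convex_on (set_constr P) (objective P) \<and>
     convex (feasible_set P) \<and>
     (\<forall>s. affine_map_on (domain P) (\<lambda>z. eq_lhs P s z - eq_rhs P s z))"

definition prob_simplex :: "(real ^ 'i) set" where
  "prob_simplex = {\<gamma>. (\<Sum>i\<in>UNIV. \<gamma> $ i) = 1 \<and> (\<forall>i. 0 \<le> \<gamma> $ i)}"

(* The index types 's and 'i play the roles of {1..N} and of the node indices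
   {1..M}; the variables are pairs (u, \<gamma>) with \<gamma> $ s $ i the weight of node i in
   scenario s. *)
definition one_step_problem ::
  "(real ^ 'm) set \<Rightarrow> (real ^ 'n \<Rightarrow> (real ^ 'm) set) \<Rightarrow>
   (real ^ 'n \<Rightarrow> real ^ 'm \<Rightarrow> real ^ 'l \<Rightarrow> real ^ 'n) \<Rightarrow>
   (real ^ 'n \<Rightarrow> real ^ 'm \<Rightarrow> real) \<Rightarrow>
   ('s::finite \<Rightarrow> real ^ 'l) \<Rightarrow> ('s \<Rightarrow> real) \<Rightarrow>
   ('i::finite \<Rightarrow> real ^ 'n) \<Rightarrow> (real ^ 'n \<Rightarrow> real) \<Rightarrow> real ^ 'n \<Rightarrow>
   ((real ^ 'm) \<times> (real ^ 'i ^ 's), 's, real ^ 'n) program" where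
  "one_step_problem U Ux f r xihat p node v x =
     \<lparr> domain = U \<times> UNIV,
       objective = (\<lambda>(u, \<gamma>). r x u + (\<Sum>s\<in>UNIV. \<Sum>i\<in>UNIV. p s * \<gamma> $ s $ i * v (node i))),
       set_constr = {(u, \<gamma>). u \<in> Ux x \<and> (\<forall>s. \<gamma> $ s \<in> prob_simplex)},
       eq_lhs = (\<lambda>s (u, \<gamma>). f x u (xihat s)),
       eq_rhs = (\<lambda>s (u, \<gamma>). \<Sum>i\<in>UNIV. \<gamma> $ s $ i *\<^sub>R node i) \<rparr>"

end

theory Submission
  imports Defs
begin

text \<open>With \<open>x\<close> fixed, the value function enters only through the constants
  \<open>v (node i)\<close>, so the expected cost-to-go is linear in the weights \<gamma>, whatever
  the shape of \<open>v\<close>; adding the stage cost, convex in \<open>u\<close>, keeps the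
  objective convex. Under (C) the dynamics are affine in \<open>u\<close>, however nonlinear
  \<open>g\<close> and \<open>h\<close> are in the state, and the interpolated successor is linear
  in \<gamma>; hence each equality constraint is affine in the pair. The feasible set is then the
  part of a convex product set on which affine maps vanish, which is convex by
  \<open>convex_affine_map_on_zeros\<close>; \<open>convex_programI\<close> assembles these
  facts.\<close>

lemma affine_map_on_subset:
  "affine_map_on T F \<Longrightarrow> S \<subseteq> T \<Longrightarrow> affine_map_on S F"
  unfolding affine_map_on_def by blast

text \<open>An affine map commutes with convex combinations, so a combination of zeros is a zero.
  Convexity of \<open>S\<close> keeps the combination where the affine formula for
  \<open>F s\<close> is valid.\<close>

lemma convex_affine_map_on_zeros:
  assumes "convex S" and "\<And>s. affine_map_on S (F s)"
  shows "convex {z \<in> S. \<forall>s. F s z = 0}"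
proof (rule convexI)
  fix y z and q w :: real
  assume y: "y \<in> {z \<in> S. \<forall>s. F s z = 0}" and z: "z \<in> {z \<in> S. \<forall>s. F s z = 0}"
    and qw: "0 \<le> q" "0 \<le> w" "q + w = 1"
  have S: "q *\<^sub>R y + w *\<^sub>R z \<in> S"
    using assms(1) y z qw by (auto intro: convexD)
  have "F s (q *\<^sub>R y + w *\<^sub>R z) = 0" for s
  proof -
    obtain A c where A: "linear A" and F: "\<forall>z\<in>S. F s z = A z + c"
      using assms(2)[of s] unfolding affine_map_on_def by blast
    \<comment> \<open>The constant term is split as \<open>(q + w) *\<^sub>R c\<close>, using
      \<open>q + w = 1\<close>, so that each endpoint receives its share.\<close>
    have "F s (q *\<^sub>R y + w *\<^sub>R z) = q *\<^sub>R A y + w *\<^sub>R A z + (q + w) *\<^sub>R c"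
      using F S A qw by (simp add: linear_add linear_scale)
    also have "\<dots> = q *\<^sub>R F s y + w *\<^sub>R F s z"
    proof -
      have "F s y = A y + c" "F s z = A z + c" using F y z by blast+
      then show ?thesis by (simp only: algebra_simps)
    qed
    finally show ?thesis using y z by simp
  qed
  with S show "q *\<^sub>R y + w *\<^sub>R z \<in> {z \<in> S. \<forall>s. F s z = 0}" by simp
qed

text \<open>Convexity of the feasible set comes for free: \<open>convex_on\<close> already contains
  convexity of \<open>set_constr P\<close>, and the constraints, affine on the domain, stay affine
  on this subset.\<close>

lemma convex_programI:
  assumes "set_constr P \<subseteq> domain P"
    and "convex_on (set_constr P) (objective P)"
    and "\<And>s. affine_map_on (domain P) (\<lambda>z. eq_lhs P s z - eq_rhs P s z)"
  shows "convex_program P"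
proof -
  have "convex {z \<in> set_constr P. \<forall>s. eq_lhs P s z - eq_rhs P s z = 0}"
    using assms by (intro convex_affine_map_on_zeros)
      (auto simp: convex_on_def intro: affine_map_on_subset)
  then show ?thesis
    using assms unfolding convex_program_def feasible_set_def by simp
qed

lemma convex_prob_simplex: "convex prob_simplex"
  by (rule convexI) (auto simp: prob_simplex_def sum.distrib simp flip: sum_distrib_left)

lemma convex_on_linear_functional:
  fixes F :: "'v::real_vector \<Rightarrow> real"
  assumes "linear F" and "convex S"
  shows "convex_on S F"
  using assms by (auto simp: convex_on_def linear_add linear_scale)

lemma convex_on_Times_fst:
  assumes "convex_on S F" and "convex T"
  shows "convex_on (S \<times> T) (\<lambda>z. F (fst z))"
  using assms by (auto simp: convex_on_def convex_Times)

theorem proposition4: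
  fixes K t Nineq :: nat
    and X :: "(real ^ 'n) set"
    and U :: "(real ^ 'm) set"
    and Ux :: "real ^ 'n \<Rightarrow> (real ^ 'm) set"
    and law :: "(real ^ 'l) pmf"
    and Xi :: "(real ^ 'l) set"
    and xihat :: "'s::finite \<Rightarrow> real ^ 'l"
    and p :: "'s \<Rightarrow> real"
    and f :: "real ^ 'n \<Rightarrow> real ^ 'm \<Rightarrow> real ^ 'l \<Rightarrow> real ^ 'n"
    and r :: "real ^ 'n \<Rightarrow> real ^ 'm \<Rightarrow> real"
    and Z :: "nat \<Rightarrow> (real ^ 'n) set"
    and node :: "'i::finite \<Rightarrow> real ^ 'n"
    and a :: "nat \<Rightarrow> real ^ 'n \<Rightarrow> real ^ 'm \<Rightarrow> real"
    and b :: "nat \<Rightarrow> real ^ 'n \<Rightarrow> real"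
    and g :: "real ^ 'n \<Rightarrow> real ^ 'l \<Rightarrow> real ^ 'n"
    and h :: "real ^ 'n \<Rightarrow> real ^ 'l \<Rightarrow> real ^ 'm ^ 'n"
    and v :: "real ^ 'n \<Rightarrow> real"
    and x :: "real ^ 'n"
  assumes K: "K \<ge> 1"
    and X_borel: "X \<in> sets borel"
    and U_borel: "U \<in> sets borel"
    and Ux: "\<And>y. y \<in> X \<Longrightarrow> Ux y \<in> sets borel \<and> Ux y \<noteq> {} \<and> Ux y \<subseteq> U"
    and Xi: "Xi = range xihat" "set_pmf law = Xi"
    and p: "\<And>s. p s = measure_pmf.prob law {xihat s}" "(\<Sum>s\<in>UNIV. p s) = 1"
    and f_maps: "\<And>y u \<xi>. y \<in> X \<Longrightarrow> u \<in> U \<Longrightarrow> \<xi> \<in> Xi \<Longrightarrow> f y u \<xi> \<in> X"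
    and f_measurable: "(\<lambda>(y, u, \<xi>). f y u \<xi>) \<in> borel_measurable (restrict_space borel (X \<times> U \<times> Xi))"
    and r_measurable: "(\<lambda>(y, u). r y u) \<in> borel_measurable (restrict_space borel (X \<times> U))"
    and Z_mono: "\<And>j. j < K \<Longrightarrow> Z j \<subseteq> Z (Suc j)"
    and Z_sub: "\<And>j. j \<le> K \<Longrightarrow> Z j \<subseteq> X"
    and Z_convex: "\<And>j. j \<le> K \<Longrightarrow> convex (Z j)"
    and Z_compact: "\<And>j. j \<le> K \<Longrightarrow> compact (Z j)"
    and Z_step: "\<And>j y u \<xi>. j < K \<Longrightarrow> y \<in> Z j \<Longrightarrow> u \<in> Ux y \<Longrightarrow> \<xi> \<in> Xi \<Longrightarrow> f y u \<xi> \<in> Z (Suc j)"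
    and Ux_ineq: "\<And>y. y \<in> X \<Longrightarrow> Ux y = {u. \<forall>k\<in>{1..Nineq}. a k y u \<le> b k y}"
    and a_convex: "\<And>k y. k \<in> {1..Nineq} \<Longrightarrow> y \<in> X \<Longrightarrow> convex_on UNIV (a k y)"
    and control_affine: "\<And>y u \<xi>. y \<in> X \<Longrightarrow> u \<in> U \<Longrightarrow> \<xi> \<in> Xi \<Longrightarrow> f y u \<xi> = g y \<xi> + h y \<xi> *v u"
    and g_measurable: "(\<lambda>(y, \<xi>). g y \<xi>) \<in> borel_measurable (restrict_space borel (X \<times> Xi))"
    and h_measurable: "(\<lambda>(y, \<xi>). h y \<xi>) \<in> borel_measurable (restrict_space borel (X \<times> Xi))"
    and g_continuous: "\<And>\<xi>. \<xi> \<in> Xi \<Longrightarrow> continuous_on X (\<lambda>y. g y \<xi>)"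
    and h_continuous: "\<And>\<xi>. \<xi> \<in> Xi \<Longrightarrow> continuous_on X (\<lambda>y. h y \<xi>)"
    and r_convex: "\<And>y. y \<in> X \<Longrightarrow> convex_on (Ux y) (r y)"
    and t: "t < K"
    and nodes: "range node \<subseteq> Z (Suc t)" "convex hull (range node) = Z (Suc t)"
    and v_bounded: "bounded (v ` Z (Suc t))"
    and v_measurable: "v \<in> borel_measurable (restrict_space borel (Z (Suc t)))"
    and x: "x \<in> Z t"
  shows "convex_program (one_step_problem U Ux f r xihat p node v x)"
proof -
  have xX: "x \<in> X" using Z_sub[of t] t x by auto
  have UxU: "Ux x \<subseteq> U" using Ux[OF xX] by blast
  \<comment> \<open>The set constraint in product form, so that convexity in \<open>u\<close> alone
    lifts to pairs.\<close>
  define S :: "((real ^ 'm) \<times> (real ^ 'i ^ 's)) set"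
    where "S = Ux x \<times> {\<gamma>. \<forall>s. \<gamma> $ s \<in> prob_simplex}"
  have weights: "convex {\<gamma> :: real ^ 'i ^ 's. \<forall>s. \<gamma> $ s \<in> prob_simplex}"
    by (rule convexI) (auto intro: convexD[OF convex_prob_simplex])
  define L :: "(real ^ 'm) \<times> (real ^ 'i ^ 's) \<Rightarrow> real"
    where "L = (\<lambda>z. \<Sum>s\<in>UNIV. \<Sum>i\<in>UNIV. p s * snd z $ s $ i * v (node i))"
  have "linear L"
    by (rule linearI) (simp_all add: L_def algebra_simps sum.distrib sum_distrib_left)
  \<comment> \<open>Convexity of \<open>Ux x\<close> is supplied by \<open>r_convex\<close>, as part
    of \<open>convex_on\<close>.\<close>
  moreover have "convex_on S (\<lambda>z. r x (fst z))"
    unfolding S_def using r_convex[OF xX] weights by (rule convex_on_Times_fst)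
  ultimately have "convex_on S (\<lambda>z. r x (fst z) + L z)"
    by (metis convex_on_add convex_on_linear_functional convex_on_imp_convex)
  \<comment> \<open>The affine formula is shown on all of \<open>U\<close>, where (C) holds, and not
    just on \<open>Ux x\<close>: the domain of the program is
    \<open>U \<times> UNIV\<close>.\<close>
  moreover have "affine_map_on (U \<times> UNIV)
      (\<lambda>z :: (real ^ 'm) \<times> (real ^ 'i ^ 's).
        f x (fst z) (xihat s) - (\<Sum>i\<in>UNIV. snd z $ s $ i *\<^sub>R node i))" for s
  proof -
    \<comment> \<open>The linear part of the constraint; the constant left over is the drift
      \<open>g x (xihat s)\<close>.\<close>
    let ?A = "\<lambda>z :: (real ^ 'm) \<times> (real ^ 'i ^ 's).
      h x (xihat s) *v fst z - (\<Sum>i\<in>UNIV. snd z $ s $ i *\<^sub>R node i)"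
    have "linear ?A"
      by (rule linearI)
        (simp_all add: matrix_vector_right_distrib matrix_vector_mult_scaleR
          scaleR_left_distrib sum.distrib scaleR_right_diff_distrib scaleR_sum_right)
    moreover have "\<forall>z\<in>U \<times> UNIV. f x (fst z) (xihat s) - (\<Sum>i\<in>UNIV. snd z $ s $ i *\<^sub>R node i)
        = ?A z + g x (xihat s)"
      using control_affine[OF xX] Xi(1) by auto
    ultimately show ?thesis unfolding affine_map_on_def by blast
  qed
  moreover have "S = {(u, \<gamma>). u \<in> Ux x \<and> (\<forall>s. \<gamma> $ s \<in> prob_simplex)}"
    by (auto simp: S_def)
  ultimately show ?thesis
    using UxU by (intro convex_programI)
      (auto simp: one_step_problem_def case_prod_unfold L_def)
qed

end
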